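(* If the vehicle dynamics are modeled as single integrators, i.e. for every vehicle $j$, $\dot x_j=u_j$, $y_j=x_j$, with $u_j\in U_j=[u_{j,min},u_{j,max}]$ and $u_{j,min}>0$, then the Job-shop Scheduling problem is equivalent to the MILP problem (both defined in the context).
   Context: **Vehicles.** There are $n$ vehicles $j\in\{1,\dots,n\}$ on predetermined paths and $m$ conflict areas $i\in\{1,\dots,m\}$; there is only one vehicle per road. Vehicle $j$ has position $y_j\in\mathbb{R}$ along its path. $\mathcal{U}_j$ is the set of input signals $u_j$ with $u_j(t)\in U_j$ for $t\ge 0$; $y_j(t,u_j,x_j(0))$ is the position reached after time $t$ from $x_j(0)$ under $u_j$, and $y_j(0)$ is the initial position. Bold symbols denote aggregates over vehicles. **Conflict structure.** $\mathcal{N}$ is the set of operations $(i,j)$ such that the path of vehicle $j$ crosses conflict area $i$; area $i$ occupies the open interval $(\alpha_{ij},\beta_{ij})$ on the path of vehicle $j$. $\mathcal{C}$ is the set of conjunctive arcs $(i,j)\to(i',j)$: vehicle $j$ crosses area $i$ and then, next on its route, area $i'$. $\mathcal{D}$ is the set of disjunctive arcs $(i,j)\leftrightarrow(i,j')$: two vehicles $j,j'$ both cross area $i$ (arcs are unordered, so conditions on them are imposed with both orderings of $j,j'$). $\mathcal{F},\mathcal{L}\subseteq\mathcal{N}$ are the sets of first and last operations on the vehicles' routes. **Job-shop Scheduling problem.** Given $\mathbf{x}(0)$, determine the existence of a schedule $\mathbf{T}=\{T_{ij}:(i,j)\in\mathcal{N}\}\in\mathbb{R}_+^{|\mathcal{N}|}$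 such that $R_{ij}\le T_{ij}\le D_{ij}$ for all $(i,j)\in\mathcal{N}$, and $T_{ij}\le T_{ij'}\Rightarrow P_{ij}\le T_{ij'}$ for all $(i,j)\leftrightarrow(i,j')\in\mathcal{D}$. Here $R_{ij},D_{ij},P_{ij}$ are defined, given $\mathbf{x}(0)$ and a schedule $\mathbf{T}=\{T_{ij}\in\mathbb{R}: y_j(T_{ij},u_j,x_j(0))=\alpha_{ij}\text{ for some }u_j\in\mathcal{U}_j,\ \forall (i,j)\in\mathcal{N}\}$, as follows. *Release times and deadlines.* If $(i,j)\in\mathcal{F}$: for $y_j(0)<\alpha_{ij}$, $R_{ij}=\min_{u_j\in\mathcal{U}_j}\{t: y_j(t,u_j,x_j(0))=\alpha_{ij}\}$ and $D_{ij}=\max_{u_j\in\mathcal{U}_j}\{t: y_j(t,u_j,x_j(0))=\alpha_{ij}\}$; for $\alpha_{ij}\le y_j(0)$, $R_{ij}=D_{ij}=0$. If $(i,j)\notin\mathcal{F}$, with $(i',j)\to(i,j)\in\mathcal{C}$: for $y_j(0)<\alpha_{ij}$, they are the same min and max with the constraint $y_j(T_{i'j},u_j,x_j(0))=\alpha_{i'j}$; for $\alpha_{ij}\le y_j(0)$, $R_{ij}=D_{ij}=0$; if the constraint cannot be satisfied by any $u_j\in\mathcal{U}_j$, $R_{ij}=\infty$ and $D_{ij}=-\infty$. *Process times.* If $(i,j)\in\mathcal{L}$: for $y_j(0)<\alpha_{ij}$, $P_{ij}=\min_{u_j\in\mathcal{U}_j}\{t:y_j(t,u_j,x_j(0))=\beta_{ij}\}$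 with the constraint $y_j(T_{ij},u_j,x_j(0))=\alpha_{ij}$; for $\alpha_{ij}\le y_j(0)<\beta_{ij}$, the same minimum without the constraint; for $\beta_{ij}\le y_j(0)$, $P_{ij}=0$. If $(i,j)\notin\mathcal{L}$, with $(i,j)\to(i',j)\in\mathcal{C}$: for $y_j(0)<\alpha_{ij}$, $P_{ij}=\min_{u_j\in\mathcal{U}_j}\{t:y_j(t,u_j,x_j(0))=\beta_{ij}\}$ with the constraints $y_j(T_{ij},u_j,x_j(0))=\alpha_{ij}$ and $y_j(T_{i'j},u_j,x_j(0))=\alpha_{i'j}$; for $\alpha_{ij}\le y_j(0)<\beta_{ij}$, the same minimum with only the constraint $y_j(T_{i'j},u_j,x_j(0))=\alpha_{i'j}$; for $\beta_{ij}\le y_j(0)$, $P_{ij}=0$. If the constraints are not satisfied, $P_{ij}=\infty$. **MILP problem.** The variables are continuous variables $T_{ij}$ for $(i,j)\in\mathcal{N}$, continuous variables $p_{ij}$ for $(i,j)\in\mathcal{N}\setminus\mathcal{L}$ (the time vehicle $j$ spends inside area $i$), and binary variables $k_{ijj'},k_{ij'j}\in\{0,1\}$ for $(i,j)\leftrightarrow(i,j')\in\mathcal{D}$. For $(i,j)\in\mathcal{L}$, $p_{ij}$ is not a variable but is set to $p_{ij}=(\beta_{ij}-\alpha_{ij})/u_{j,max}$. Given $\mathbf{x}(0)$, determine if there exists a feasible solution subject to the following constraints. A. If $(i,j)\in\mathcal{F}$: for $y_j(0)<\alpha_{ij}$, $\frac{\alpha_{ij}-y_j(0)}{u_{j,max}}\le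 T_{ij}\le\frac{\alpha_{ij}-y_j(0)}{u_{j,min}}$; for $\alpha_{ij}\le y_j(0)$, $T_{ij}=0$. B. If $(i,j)\notin\mathcal{F}$, with $(i',j)\to(i,j)\in\mathcal{C}$: $T_{i'j}+p_{i'j}+\frac{\alpha_{ij}-\beta_{i'j}}{u_{j,max}}\le T_{ij}\le T_{i'j}+p_{i'j}+\frac{\alpha_{ij}-\beta_{i'j}}{u_{j,min}}$. C. If $(i,j)\notin\mathcal{L}$: for $y_j(0)<\alpha_{ij}$, $\frac{\beta_{ij}-\alpha_{ij}}{u_{j,max}}\le p_{ij}\le\frac{\beta_{ij}-\alpha_{ij}}{u_{j,min}}$; for $\alpha_{ij}\le y_j(0)$, instead $\frac{\beta_{ij}-y_j(0)}{u_{j,max}}\le p_{ij}\le\frac{\beta_{ij}-y_j(0)}{u_{j,min}}$; if $\beta_{ij}\le y_j(0)$, the schedule of operation $(i,j)$ is not of interest. D. For all $(i,j)\leftrightarrow(i,j')\in\mathcal{D}$, with a large number $M\in\mathbb{R}_+$ (sufficiently larger than all $T_{ij}$ and $P_{ij}$): $T_{ij}+p_{ij}\le T_{ij'}+M(1-k_{ijj'})$, $T_{ij'}+p_{ij'}\le T_{ij}+M(1-k_{ij'j})$, $k_{ijj'}+k_{ij'j}=1$. **Equivalence of problems.** An instance of a problem is the information required to solve it; $I_A\in$ Problem A means that $I_A$ satisfies Problem A (the answer is yes). For both problems here an instance is $I=\{\mathbf{x}(0),\Theta\}$, where $\Theta$ consists of all $\alpha_{ij},\beta_{ij}$, the vehicle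 dynamics, the state, output and input spaces and the set of input signals, and $\mathcal{N},\mathcal{F},\mathcal{L},\mathcal{C},\mathcal{D}$. Problem A is reducible to Problem B if for any instance $I_A$ of A an instance $I_B$ of B can be constructed in polynomial time, and $I_A\in$ A if and only if $I_B\in$ B. A and B are equivalent if each is reducible to the other.
   Formalization: Areas on a path are disjoint; if a vehicle starts inside its last area, p is (β−y(0))/u_max; areas already left are dropped from both problems (A then applies to the first one remaining); R and D ignore a predecessor whose entry is already passed. As printed, the same-instance equivalence fails. *)

theory Defs
  imports "HOL-Analysis.Analysis"
begin

section \<open>Conflict structure\<close>

text \<open>
  Vehicles are numbered \<open>1..n\<close> and conflict areas \<open>1..m\<close>; the pair \<open>(i, j)\<close> is the operation
  ``vehicle \<open>j\<close> crosses area \<open>i\<close>''.  On the path of vehicle \<open>j\<close>, area \<open>i\<close> is the open interval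
  from \<open>alpha i j\<close> to \<open>beta i j\<close>.
\<close>

record layout =
  num_vehicles :: nat
  num_areas :: nat
  ops :: "(nat \<times> nat) set"
  alpha :: "nat \<Rightarrow> nat \<Rightarrow> real"
  beta :: "nat \<Rightarrow> nat \<Rightarrow> real"

text \<open>
  The areas that a vehicle crosses are disjoint intervals of its path, so that it leaves an area
  before it enters the next one.  The route of a vehicle is the order of these intervals, and
  therefore the arcs and the first and last operations are determined by the layout.
\<close>

definition valid_layout :: "'z layout_scheme \<Rightarrow> bool" where
  "valid_layout L \<longleftrightarrow>
     ops L \<subseteq> {1..num_areas L} \<times> {1..num_vehicles L} \<and>
     (\<forall>(i, j) \<in> ops L. alpha L i j < beta L i j) \<and>
     (\<forall>i i' j. (i, j) \<in> ops L \<and> (i', j) \<in> ops L \<and> i \<noteq> i' \<longrightarrow>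
        beta L i j \<le> alpha L i' j \<or> beta L i' j \<le> alpha L i j)"

text \<open>\<open>(i, i', j) \<in> conj_arcs L\<close> stands for the arc from \<open>(i, j)\<close> to \<open>(i', j)\<close>.\<close>

definition conj_arcs :: "'z layout_scheme \<Rightarrow> (nat \<times> nat \<times> nat) set" where
  "conj_arcs L = {(i, i', j). (i, j) \<in> ops L \<and> (i', j) \<in> ops L \<and> alpha L i j < alpha L i' j \<and>
     \<not> (\<exists>k. (k, j) \<in> ops L \<and> alpha L i j < alpha L k j \<and> alpha L k j < alpha L i' j)}"

text \<open>\<open>(i, j, j') \<in> disj_arcs L\<close> stands for the unordered arc between \<open>(i, j)\<close> and \<open>(i, j')\<close>; it
  is represented by both \<open>(i, j, j')\<close> and \<open>(i, j', j)\<close>.\<close>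

definition disj_arcs :: "'z layout_scheme \<Rightarrow> (nat \<times> nat \<times> nat) set" where
  "disj_arcs L = {(i, j, j'). (i, j) \<in> ops L \<and> (i, j') \<in> ops L \<and> j \<noteq> j'}"

definition first_ops :: "'z layout_scheme \<Rightarrow> (nat \<times> nat) set" where
  "first_ops L = {(i, j) \<in> ops L. \<not> (\<exists>i'. (i', i, j) \<in> conj_arcs L)}"

definition last_ops :: "'z layout_scheme \<Rightarrow> (nat \<times> nat) set" where
  "last_ops L = {(i, j) \<in> ops L. \<not> (\<exists>i'. (i, i', j) \<in> conj_arcs L)}"

text \<open>
  If vehicle \<open>j\<close> has already left area \<open>i\<close>, the schedule of \<open>(i, j)\<close> is not of interest.
  \<open>residual y0 L\<close> keeps the operations that are still of interest for the initial positions \<open>y0\<close>.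
\<close>

definition residual :: "(nat \<Rightarrow> real) \<Rightarrow> 'z layout_scheme \<Rightarrow> 'z layout_scheme" where
  "residual y0 L = L\<lparr>ops := {(i, j) \<in> ops L. y0 j < beta L i j}\<rparr>"


section \<open>The job-shop scheduling problem\<close>

record ('x, 'u) traffic = layout +
  init_state :: "nat \<Rightarrow> 'x"
  flow :: "nat \<Rightarrow> real \<Rightarrow> (real \<Rightarrow> 'u) \<Rightarrow> 'x \<Rightarrow> 'x"
  outp :: "nat \<Rightarrow> 'x \<Rightarrow> real"
  signals :: "nat \<Rightarrow> (real \<Rightarrow> 'u) set"

definition pos0 :: "('x, 'u) traffic \<Rightarrow> nat \<Rightarrow> real" where
  "pos0 S j = outp S j (init_state S j)"

definition pos :: "('x, 'u) traffic \<Rightarrow> nat \<Rightarrow> real \<Rightarrow> (real \<Rightarrow> 'u) \<Rightarrow> real" where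
  "pos S j t u = outp S j (flow S j t u (init_state S j))"

text \<open>
  The times at which vehicle \<open>j\<close> can enter area \<open>i\<close> when it enters the preceding area on schedule.
  There is no constraint for a first operation.  The entry into an area that vehicle \<open>j\<close> has
  already passed at time 0 is not constrained either, since no input signal affects it.
\<close>

definition entry_times :: "('x, 'u) traffic \<Rightarrow> (nat \<Rightarrow> nat \<Rightarrow> real) \<Rightarrow> nat \<Rightarrow> nat \<Rightarrow> real set" where
  "entry_times S T i j = {t. 0 \<le> t \<and> (\<exists>u \<in> signals S j. pos S j t u = alpha S i j \<and>
     (\<forall>i'. (i', i, j) \<in> conj_arcs S \<and> pos0 S j \<le> alpha S i' j \<longrightarrow>
        pos S j (T i' j) u = alpha S i' j))}"

text \<open>
  Minima and maxima are taken in the extended reals, where \<open>Inf {} = \<infinity>\<close> and \<open>Sup {} = -\<infinity>\<close> are the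
  values prescribed for constraints that no input signal satisfies.
\<close>

definition release :: "('x, 'u) traffic \<Rightarrow> (nat \<Rightarrow> nat \<Rightarrow> real) \<Rightarrow> nat \<Rightarrow> nat \<Rightarrow> ereal" where
  "release S T i j = (if pos0 S j < alpha S i j then Inf (ereal ` entry_times S T i j) else 0)"

definition deadline :: "('x, 'u) traffic \<Rightarrow> (nat \<Rightarrow> nat \<Rightarrow> real) \<Rightarrow> nat \<Rightarrow> nat \<Rightarrow> ereal" where
  "deadline S T i j = (if pos0 S j < alpha S i j then Sup (ereal ` entry_times S T i j) else 0)"

text \<open>The constraint on the entry into the next area is absent exactly for last operations.\<close>

definition exit_times :: "('x, 'u) traffic \<Rightarrow> (nat \<Rightarrow> nat \<Rightarrow> real) \<Rightarrow> nat \<Rightarrow> nat \<Rightarrow> real set" where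
  "exit_times S T i j = {t. 0 \<le> t \<and> (\<exists>u \<in> signals S j. pos S j t u = beta S i j \<and>
     (pos0 S j < alpha S i j \<longrightarrow> pos S j (T i j) u = alpha S i j) \<and>
     (\<forall>i'. (i, i', j) \<in> conj_arcs S \<longrightarrow> pos S j (T i' j) u = alpha S i' j))}"

definition process :: "('x, 'u) traffic \<Rightarrow> (nat \<Rightarrow> nat \<Rightarrow> real) \<Rightarrow> nat \<Rightarrow> nat \<Rightarrow> ereal" where
  "process S T i j = (if pos0 S j < beta S i j then Inf (ereal ` exit_times S T i j) else 0)"

definition job_shop :: "('x, 'u) traffic \<Rightarrow> bool" where
  "job_shop S \<longleftrightarrow> (\<exists>T :: nat \<Rightarrow> nat \<Rightarrow> real.
     (\<forall>(i, j) \<in> ops S. 0 \<le> T i j \<and> release S T i j \<le> ereal (T i j) \<and>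
        ereal (T i j) \<le> deadline S T i j) \<and>
     (\<forall>(i, j, j') \<in> disj_arcs (residual (pos0 S) S).
        T i j \<le> T i j' \<longrightarrow> process S T i j \<le> ereal (T i j')))"


section \<open>Single integrators\<close>

record integrator_instance = layout +
  x_init :: "nat \<Rightarrow> real"
  u_min :: "nat \<Rightarrow> real"
  u_max :: "nat \<Rightarrow> real"

definition valid_instance :: "integrator_instance \<Rightarrow> bool" where
  "valid_instance I \<longleftrightarrow> valid_layout I \<and>
     (\<forall>j \<in> {1..num_vehicles I}. 0 < u_min I j \<and> u_min I j \<le> u_max I j)"

text \<open>
  The input signals are those for which \<open>x' = u\<close> has a (Caratheodory) solution.  Together with the
  bounds, integrability on every \<open>{0..t}\<close> amounts to Lebesgue measurability.
\<close>

definition single_integrator :: "integrator_instance \<Rightarrow> (real, real) traffic" where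
  "single_integrator I =
     \<lparr>num_vehicles = num_vehicles I, num_areas = num_areas I, ops = ops I,
      alpha = alpha I, beta = beta I,
      init_state = x_init I,
      flow = (\<lambda>j t u x. x + integral {0..t} u),
      outp = (\<lambda>j x. x),
      signals = (\<lambda>j. {u. \<forall>t \<ge> 0. u t \<in> {u_min I j..u_max I j} \<and> u integrable_on {0..t}})\<rparr>"


section \<open>The MILP problem\<close>

text \<open>
  The constraints on the continuous variables, for an instance \<open>I\<close> all of whose operations are still
  of interest.  The value of \<open>p\<close> for a last operation is the time that remains to be spent in the
  area at maximal speed, also for a vehicle that is inside the area at time 0.
\<close>

definition milp_times ::
  "integrator_instance \<Rightarrow> (nat \<Rightarrow> nat \<Rightarrow> real) \<Rightarrow> (nat \<Rightarrow> nat \<Rightarrow> real) \<Rightarrow> bool" where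
  "milp_times I T p \<longleftrightarrow>
     (\<forall>(i, j) \<in> first_ops I.
        if x_init I j < alpha I i j
        then (alpha I i j - x_init I j) / u_max I j \<le> T i j \<and>
             T i j \<le> (alpha I i j - x_init I j) / u_min I j
        else T i j = 0) \<and>
     (\<forall>(i', i, j) \<in> conj_arcs I.
        T i' j + p i' j + (alpha I i j - beta I i' j) / u_max I j \<le> T i j \<and>
        T i j \<le> T i' j + p i' j + (alpha I i j - beta I i' j) / u_min I j) \<and>
     (\<forall>(i, j) \<in> ops I - last_ops I.
        if x_init I j < alpha I i j
        then (beta I i j - alpha I i j) / u_max I j \<le> p i j \<and>
             p i j \<le> (beta I i j - alpha I i j) / u_min I j
        else (beta I i j - x_init I j) / u_max I j \<le> p i j \<and>
             p i j \<le> (beta I i j - x_init I j) / u_min I j) \<and>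
     (\<forall>(i, j) \<in> last_ops I.
        p i j = (if x_init I j < alpha I i j
                 then (beta I i j - alpha I i j) / u_max I j
                 else (beta I i j - x_init I j) / u_max I j))"

definition milp_order ::
  "integrator_instance \<Rightarrow> real \<Rightarrow> (nat \<Rightarrow> nat \<Rightarrow> real) \<Rightarrow> (nat \<Rightarrow> nat \<Rightarrow> real) \<Rightarrow>
   (nat \<Rightarrow> nat \<Rightarrow> nat \<Rightarrow> real) \<Rightarrow> bool" where
  "milp_order I M T p k \<longleftrightarrow>
     (\<forall>(i, j, j') \<in> disj_arcs I.
        k i j j' \<in> {0, 1} \<and> k i j' j \<in> {0, 1} \<and>
        T i j + p i j \<le> T i j' + M * (1 - k i j j') \<and>
        T i j' + p i j' \<le> T i j + M * (1 - k i j' j) \<and>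
        k i j j' + k i j' j = 1)"

definition milp :: "real \<Rightarrow> integrator_instance \<Rightarrow> bool" where
  "milp M I \<longleftrightarrow> (let J = residual (x_init I) I in \<exists>T p k. milp_times J T p \<and> milp_order J M T p k)"

text \<open>\<open>M\<close> exceeds all entry times \<open>T i j\<close> and all exit times \<open>T i j + p i j\<close> that can occur.\<close>

definition sufficiently_large :: "integrator_instance \<Rightarrow> real \<Rightarrow> bool" where
  "sufficiently_large I M \<longleftrightarrow> (let J = residual (x_init I) I in 0 \<le> M \<and>
     (\<forall>T p. milp_times J T p \<longrightarrow> (\<forall>(i, j) \<in> ops J. T i j < M \<and> T i j + p i j < M)))"

text \<open>Every valid instance admits such an \<open>M\<close>.\<close>

lemma milp_times_bounded:
  assumes "valid_instance I" and J: "J = residual (x_init I) I"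
    and mt: "milp_times J T p" and "(i, j) \<in> ops J"
  shows "T i j \<le> max 0 ((alpha I i j - x_init I j) / u_min I j) \<and>
         T i j + p i j \<le> (beta I i j - x_init I j) / u_min I j"
  using assms(4)
proof (induction "card {i'. (i', j) \<in> ops J \<and> alpha I i' j < alpha I i j}" arbitrary: i
    rule: less_induct)
  case less
  have sel: "alpha J = alpha I" "beta J = beta I" "x_init J = x_init I" "u_min J = u_min I"
    "u_max J = u_max I" and opsJ: "ops J = {(i, j) \<in> ops I. x_init I j < beta I i j}"
    by (simp_all add: J residual_def)
  let ?x = "x_init I j"
  have ij: "(i, j) \<in> ops I" "?x < beta I i j" using less.prems opsJ by auto
  have vl: "ops I \<subseteq> {1..num_areas I} \<times> {1..num_vehicles I}"
    "\<And>i j. (i, j) \<in> ops I \<Longrightarrow> alpha I i j < beta I i j"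
    "\<And>i i' j. (i, j) \<in> ops I \<Longrightarrow> (i', j) \<in> ops I \<Longrightarrow> i \<noteq> i' \<Longrightarrow>
        beta I i j \<le> alpha I i' j \<or> beta I i' j \<le> alpha I i j"
    using assms(1) unfolding valid_instance_def valid_layout_def by blast+
  have fin_I: "finite (ops I)" using vl(1) by (rule finite_subset) simp
  have ab: "alpha I i j < beta I i j" using vl(2) ij by blast
  have um: "0 < u_min I j" "u_min I j \<le> u_max I j"
    using assms(1) ij(1) vl(1) unfolding valid_instance_def by auto
  define e where "e = (if ?x < alpha I i j then alpha I i j else ?x)"
  have p_le: "p i j \<le> (beta I i j - e) / u_min I j"
  proof (cases "(i, j) \<in> last_ops J")
    case True
    have "\<forall>(i, j) \<in> last_ops J. p i j = (if x_init J j < alpha J i j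
         then (beta J i j - alpha J i j) / u_max J j else (beta J i j - x_init J j) / u_max J j)"
      using mt unfolding milp_times_def by (elim conjE)
    from bspec[OF this True] have "p i j = (beta I i j - e) / u_max I j"
      by (simp add: sel e_def)
    also have "\<dots> \<le> (beta I i j - e) / u_min I j"
      using um ab ij unfolding e_def by (intro divide_left_mono) auto
    finally show ?thesis .
  next
    case False
    then have "(i, j) \<in> ops J - last_ops J" using less.prems by simp
    moreover have "\<forall>(i, j) \<in> ops J - last_ops J.
        if x_init J j < alpha J i j
        then (beta J i j - alpha J i j) / u_max J j \<le> p i j \<and>
             p i j \<le> (beta J i j - alpha J i j) / u_min J j
        else (beta J i j - x_init J j) / u_max J j \<le> p i j \<and>
             p i j \<le> (beta J i j - x_init J j) / u_min J j"
      using mt unfolding milp_times_def by (elim conjE)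
    ultimately show ?thesis by (auto simp: sel e_def dest!: bspec split: if_splits)
  qed
  have T_le: "T i j \<le> (e - ?x) / u_min I j"
  proof (cases "(i, j) \<in> first_ops J")
    case True
    have "\<forall>(i, j) \<in> first_ops J. if x_init J j < alpha J i j
        then (alpha J i j - x_init J j) / u_max J j \<le> T i j \<and>
             T i j \<le> (alpha J i j - x_init J j) / u_min J j
        else T i j = 0"
      using mt unfolding milp_times_def by (elim conjE)
    from bspec[OF this True] show ?thesis by (auto simp: sel e_def split: if_splits)
  next
    case False
    then obtain i' where arc: "(i', i, j) \<in> conj_arcs J"
      using less.prems unfolding first_ops_def by auto
    then have i': "(i', j) \<in> ops J" "alpha I i' j < alpha I i j"
      using sel unfolding conj_arcs_def by auto
    have "{k. (k, j) \<in> ops J} \<subseteq> fst ` ops I" using opsJ by force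
    then have fin: "finite {k. (k, j) \<in> ops J}" using fin_I finite_subset by blast
    have "card {k. (k, j) \<in> ops J \<and> alpha I k j < alpha I i' j}
        < card {k. (k, j) \<in> ops J \<and> alpha I k j < alpha I i j}"
    proof (rule psubset_card_mono)
      show "finite {k. (k, j) \<in> ops J \<and> alpha I k j < alpha I i j}"
        using fin by (rule finite_subset[rotated]) auto
      show "{k. (k, j) \<in> ops J \<and> alpha I k j < alpha I i' j}
          \<subset> {k. (k, j) \<in> ops J \<and> alpha I k j < alpha I i j}"
        using i' by auto
    qed
    from less.hyps[OF this i'(1)]
    have "T i' j + p i' j \<le> (beta I i' j - ?x) / u_min I j" by simp
    moreover have "\<forall>(i', i, j) \<in> conj_arcs J.
        T i' j + p i' j + (alpha J i j - beta J i' j) / u_max J j \<le> T i j \<and>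
        T i j \<le> T i' j + p i' j + (alpha J i j - beta J i' j) / u_min J j"
      using mt unfolding milp_times_def by (elim conjE)
    from bspec[OF this arc]
    have "T i j \<le> T i' j + p i' j + (alpha I i j - beta I i' j) / u_min I j"
      by (simp add: sel)
    moreover have b': "(i', j) \<in> ops I" "?x < beta I i' j" using i' opsJ by auto
    moreover have "beta I i' j \<le> alpha I i j"
      using vl(3)[OF b'(1) ij(1)] i'(2) ab by fastforce
    ultimately show ?thesis by (auto simp: e_def diff_divide_distrib)
  qed
  then have "T i j \<le> max 0 ((alpha I i j - ?x) / u_min I j)"
    unfolding e_def by (auto split: if_splits)
  moreover have "T i j + p i j \<le> (beta I i j - ?x) / u_min I j"
    using T_le p_le by (simp add: diff_divide_distrib)
  ultimately show ?case by simp
qed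

lemma ex_sufficiently_large:
  assumes "valid_instance I"
  shows "\<exists>M. sufficiently_large I M"
proof -
  define J where "J = residual (x_init I) I"
  define b where "b = (\<lambda>(i, j). max 0 ((alpha I i j - x_init I j) / u_min I j) +
    \<bar>(beta I i j - x_init I j) / u_min I j\<bar>)"
  have "ops I \<subseteq> {1..num_areas I} \<times> {1..num_vehicles I}"
    using assms unfolding valid_instance_def valid_layout_def by blast
  then have "finite (ops I)" by (rule finite_subset) simp
  then have fin: "finite (ops J)"
    by (rule finite_subset[rotated]) (auto simp: J_def residual_def)
  have b0: "0 \<le> b x" for x by (cases x) (simp add: b_def)
  define M where "M = 1 + sum b (ops J)"
  have "T i j < M \<and> T i j + p i j < M" if "milp_times J T p" "(i, j) \<in> ops J" for T p i j
  proof -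
    have "b (i, j) \<le> sum b (ops J)" using fin that b0 by (intro member_le_sum) auto
    then show ?thesis
      using milp_times_bounded[OF assms J_def that] unfolding M_def b_def prod.case by linarith
  qed
  moreover have "0 \<le> M" using b0 by (simp add: M_def sum_nonneg)
  ultimately show ?thesis
    unfolding sufficiently_large_def J_def Let_def by blast
qed


section \<open>Polynomial-time reductions\<close>

text \<open>
  Instances contain real numbers, so polynomial time is taken with respect to the machines of
  Blum, Shub and Smale over the reals: a program works on a two-way infinite tape of real cells,
  addresses cells at fixed offsets from the head, and each arithmetic operation, comparison or
  shift of the tape by one cell costs one step.
\<close>

datatype instr =
    Const int real
  | Add int int int
  | Sub int int int
  | Mul int int int
  | Div int int int
  | Shift_Left
  | Shift_Right
  | Jump_Nonneg nat

type_synonym tape = "int \<Rightarrow> real"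

fun exec :: "instr \<Rightarrow> nat \<times> tape \<Rightarrow> nat \<times> tape" where
  "exec (Const d c) (pc, t) = (Suc pc, t(d := c))"
| "exec (Add d a b) (pc, t) = (Suc pc, t(d := t a + t b))"
| "exec (Sub d a b) (pc, t) = (Suc pc, t(d := t a - t b))"
| "exec (Mul d a b) (pc, t) = (Suc pc, t(d := t a * t b))"
| "exec (Div d a b) (pc, t) = (Suc pc, t(d := t a / t b))"
| "exec Shift_Left (pc, t) = (Suc pc, \<lambda>z. t (z + 1))"
| "exec Shift_Right (pc, t) = (Suc pc, \<lambda>z. t (z - 1))"
| "exec (Jump_Nonneg l) (pc, t) = ((if 0 \<le> t 0 then l else Suc pc), t)"

definition step :: "instr list \<Rightarrow> nat \<times> tape \<Rightarrow> nat \<times> tape" where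
  "step prog c = (if fst c < length prog then exec (prog ! fst c) c else c)"

text \<open>A word is stored on the tape as its length in cell 0, followed by its entries.\<close>

definition input_tape :: "real list \<Rightarrow> tape" where
  "input_tape xs z = (if z = 0 then real (length xs)
     else if 1 \<le> z \<and> z \<le> int (length xs) then xs ! nat (z - 1) else 0)"

definition output_on :: "tape \<Rightarrow> real list \<Rightarrow> bool" where
  "output_on t ys \<longleftrightarrow> t 0 = real (length ys) \<and> (\<forall>k < length ys. t (int k + 1) = ys ! k)"

definition computes_within :: "instr list \<Rightarrow> real list \<Rightarrow> nat \<Rightarrow> real list \<Rightarrow> bool" where
  "computes_within prog xs s ys \<longleftrightarrow>
     (\<exists>pc t. (step prog ^^ s) (0, input_tape xs) = (pc, t) \<and> length prog \<le> pc \<and> output_on t ys)"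

record 'a problem =
  instances :: "'a set"
  encode :: "'a \<Rightarrow> real list"
  yes :: "'a set"

definition polytime_construction :: "'a problem \<Rightarrow> 'b problem \<Rightarrow> ('a \<Rightarrow> 'b) \<Rightarrow> bool" where
  "polytime_construction A B f \<longleftrightarrow>
     (\<exists>prog c d. \<forall>I \<in> instances A.
        f I \<in> instances B \<and>
        computes_within prog (encode A I) (c * length (encode A I) ^ d + c) (encode B (f I)))"

definition reducible :: "'a problem \<Rightarrow> 'b problem \<Rightarrow> bool" where
  "reducible A B \<longleftrightarrow>
     (\<exists>f. polytime_construction A B f \<and> (\<forall>I \<in> instances A. I \<in> yes A \<longleftrightarrow> f I \<in> yes B))"

definition equivalent :: "'a problem \<Rightarrow> 'b problem \<Rightarrow> bool" where
  "equivalent A B \<longleftrightarrow> reducible A B \<and> reducible B A"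

text \<open>The values of \<open>alpha\<close> and \<open>beta\<close> outside \<open>ops\<close> are not part of the instance data.\<close>

definition encode_instance :: "integrator_instance \<Rightarrow> real list" where
  "encode_instance I =
     [real (num_vehicles I), real (num_areas I)] @
     concat (map (\<lambda>j. [x_init I j, u_min I j, u_max I j]) [1..<Suc (num_vehicles I)]) @
     concat (map (\<lambda>j. concat (map (\<lambda>i. if (i, j) \<in> ops I then [1, alpha I i j, beta I i j]
                                         else [0, 0, 0])
                        [1..<Suc (num_areas I)]))
              [1..<Suc (num_vehicles I)])"

definition job_shop_problem :: "integrator_instance problem" where
  "job_shop_problem =
     \<lparr>instances = {I. valid_instance I}, encode = encode_instance,
      yes = {I. valid_instance I \<and> job_shop (single_integrator I)}\<rparr>"

definition milp_problem :: "(integrator_instance \<Rightarrow> real) \<Rightarrow> integrator_instance problem" where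
  "milp_problem M =
     \<lparr>instances = {I. valid_instance I}, encode = encode_instance,
      yes = {I. valid_instance I \<and> milp (M I) I}\<rparr>"

end

theory Submission
  imports Defs
begin

text \<open>
  Both problems have the same instances and encodings, so the identity, computed by the empty
  program, is the reduction in either direction.  A single integrator can pass through given
  positions at given times if and only if the average speed on every leg lies between the speed
  bounds: a piecewise constant signal suffices.  Hence the release times and deadlines become
  bounds on \<open>T i j - T i' j\<close> along the conjunctive arcs.  The MILP splits each such leg at the exit
  from the area, at time \<open>T i j + p i j\<close>; its solutions \<open>p\<close> are exactly the choices of
  \<open>T i j + p i j\<close> among the exit times (the earliest one, for a last operation), and the process
  time is the least exit time.  Since a vehicle leaves an area strictly after it enters, the
  binary variables just record which of two vehicles enters first.
\<close>

section \<open>Signals through prescribed waypoints\<close>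

text \<open>Multiplied out rather than bounding the average speed \<open>d / \<tau>\<close>: a leg
  of duration 0 needs no separate case, and the conditions on consecutive legs can be added.\<close>

definition travel :: "real \<Rightarrow> real \<Rightarrow> real \<Rightarrow> real \<Rightarrow> bool" where
  "travel lo hi d \<tau> \<longleftrightarrow> lo * \<tau> \<le> d \<and> d \<le> hi * \<tau>"

lemma travel_iff:
  assumes "0 < lo" "lo \<le> hi"
  shows "travel lo hi d \<tau> \<longleftrightarrow> d / hi \<le> \<tau> \<and> \<tau> \<le> d / lo"
  using assms by (auto simp: travel_def pos_divide_le_eq pos_le_divide_eq mult.commute)

lemma travel_add:
  "travel lo hi d \<tau> \<Longrightarrow> travel lo hi d' \<tau>' \<Longrightarrow> travel lo hi (d + d') (\<tau> + \<tau>')"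
  by (simp add: travel_def distrib_left)

lemma travel_nonneg:
  assumes "travel lo hi d \<tau>" "0 \<le> d" "0 < lo" "lo \<le> hi"
  shows "0 \<le> \<tau>"
proof (rule ccontr)
  assume "\<not> 0 \<le> \<tau>"
  then have "hi * \<tau> < 0" using assms by (intro mult_pos_neg) auto
  with assms show False by (simp add: travel_def)
qed

lemma travel_0_iff:
  assumes "0 < lo" "lo \<le> hi"
  shows "travel lo hi 0 \<tau> \<longleftrightarrow> \<tau> = 0"
  using assms by (auto simp: travel_iff)

definition admissible :: "real \<Rightarrow> real \<Rightarrow> (real \<Rightarrow> real) set" where
  "admissible lo hi = {u. \<forall>t \<ge> 0. u t \<in> {lo..hi} \<and> u integrable_on {0..t}}"

lemma const_admissible: "lo \<le> hi \<Longrightarrow> (\<lambda>_. lo) \<in> admissible lo hi"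
  by (auto simp: admissible_def)

lemma admissible_travel:
  assumes u: "u \<in> admissible lo hi" and "0 \<le> s" "s \<le> t"
  shows "travel lo hi (integral {0..t} u - integral {0..s} u) (t - s)"
proof -
  have int: "u integrable_on {0..t}" using u assms by (auto simp: admissible_def)
  have int': "u integrable_on {s..t}"
    using int by (rule integrable_on_subinterval) (use assms in auto)
  have "integral {0..s} u + integral {s..t} u = integral {0..t} u"
    using assms int by (intro Henstock_Kurzweil_Integration.integral_combine) auto
  moreover have "integral {s..t} (\<lambda>_. lo) \<le> integral {s..t} u"
    using u assms int' by (intro integral_le) (auto simp: admissible_def)
  moreover have "integral {s..t} u \<le> integral {s..t} (\<lambda>_. hi)"
    using u assms int' by (intro integral_le) (auto simp: admissible_def)
  ultimately show ?thesis using assms by (simp add: travel_def mult.commute)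
qed

text \<open>Keep \<open>u\<close> up to time \<open>s\<close> and continue at the constant speed
  that covers the distance \<open>d\<close> by time \<open>t\<close>.\<close>

lemma admissible_extend:
  assumes u: "u \<in> admissible lo hi" and st: "0 \<le> s" "s \<le> t" and d: "travel lo hi d (t - s)"
    and "lo \<le> hi"
  obtains v where "v \<in> admissible lo hi"
    "\<And>r. r \<in> {0..s} \<Longrightarrow> integral {0..r} v = integral {0..r} u"
    "integral {0..t} v = integral {0..s} u + d"
proof -
  \<comment> \<open>If \<open>s = t\<close>, the hypothesis on \<open>d\<close> forces
    \<open>d = 0\<close>, and any speed within the bounds will do.\<close>
  define c where "c = (if s < t then d / (t - s) else lo)"
  have c: "c \<in> {lo..hi}" "c * (t - s) = d"
    using d st \<open>lo \<le> hi\<close>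
    by (auto simp: c_def travel_def pos_le_divide_eq pos_divide_le_eq)
  define v where "v r = (if r \<le> s then u r else c)" for r
  have agree: "(v has_integral integral {0..r} u) {0..r}" if "r \<in> {0..s}" for r
  proof -
    have "(u has_integral integral {0..r} u) {0..r}"
      using u that by (auto simp: admissible_def)
    then show ?thesis
      by (rule has_integral_eq[rotated]) (use that in \<open>auto simp: v_def\<close>)
  qed
  have beyond: "(v has_integral (integral {0..s} u + c * (r - s))) {0..r}" if "s \<le> r" for r
  proof (rule has_integral_combine[of 0 s r])
    show "(v has_integral c * (r - s)) {s..r}"
    \<comment> \<open>At the junction \<open>s\<close> the value of \<open>v\<close> is still
      \<open>u s\<close>, which changes the constant only on a null set.\<close>
    proof (rule has_integral_spike[where S = "{s}"])
      show "((\<lambda>_. c) has_integral c * (r - s)) {s..r}"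
        using has_integral_const_real[of c s r] that by (simp add: mult.commute)
    qed (auto simp: v_def)
  qed (use st that agree in auto)
  have "v integrable_on {0..r}" if "0 \<le> r" for r
    using agree[of r] beyond[of r] that by (cases "r \<le> s") (auto simp: integrable_on_def)
  then have "v \<in> admissible lo hi"
    using u c st by (auto simp: admissible_def v_def)
  then show thesis
    using that agree beyond[OF \<open>s \<le> t\<close>] c(2) integral_unique by metis
qed

text \<open>Legs of constant speed are appended one at a time. The agreement of the integrals up to
  \<open>s\<close> is part of the induction so that later extensions preserve the waypoints already
  met. Only the positions are assumed sorted; the order of the times follows from
  \<open>travel_nonneg\<close>.\<close>

lemma signal_through_waypoints:
  assumes "0 < lo" "lo \<le> hi" "u \<in> admissible lo hi" "0 \<le> s" "integral {0..s} u = y"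
    and "sorted (y # map snd ws)"
    and "successively (\<lambda>(s, y) (t, z). travel lo hi (z - y) (t - s)) ((s, y) # ws)"
  shows "\<exists>v \<in> admissible lo hi. (\<forall>r \<in> {0..s}. integral {0..r} v = integral {0..r} u) \<and>
    (\<forall>(t, z) \<in> set ws. integral {0..t} v = z)"
  using assms(3-)
proof (induction ws arbitrary: u s y)
  case Nil
  then show ?case by auto
next
  case (Cons w ws)
  obtain t z where w: "w = (t, z)" by force
  have tr: "travel lo hi (z - y) (t - s)" using Cons.prems w by simp
  moreover have "y \<le> z" using Cons.prems w by simp
  ultimately have st: "s \<le> t" using travel_nonneg[OF tr] assms by simp
  obtain v where v: "v \<in> admissible lo hi"
    "\<And>r. r \<in> {0..s} \<Longrightarrow> integral {0..r} v = integral {0..r} u"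
    "integral {0..t} v = integral {0..s} u + (z - y)"
    using admissible_extend[OF Cons.prems(1,2) st tr \<open>lo \<le> hi\<close>] by blast
  from v(3) have vt: "integral {0..t} v = z" using Cons.prems(3) by simp
  have "\<exists>v' \<in> admissible lo hi. (\<forall>r \<in> {0..t}. integral {0..r} v' = integral {0..r} v) \<and>
    (\<forall>(t, z) \<in> set ws. integral {0..t} v' = z)"
    using Cons.IH[OF v(1) _ vt] Cons.prems st w by simp
  then obtain v' where v': "v' \<in> admissible lo hi"
    "\<And>r. r \<in> {0..t} \<Longrightarrow> integral {0..r} v' = integral {0..r} v"
    "\<forall>(t, z) \<in> set ws. integral {0..t} v' = z" by blast
  have "integral {0..r} v' = integral {0..r} u" if "r \<in> {0..s}" for r
    using v'(2)[of r] v(2)[OF that] that st by simp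
  moreover have "integral {0..t} v' = z" using v'(2)[of t] vt st Cons.prems(2) by simp
  ultimately show ?case using v'(1,3) w by (intro bexI[of _ v']) auto
qed

lemma waypoints_travel:
  assumes "0 < lo" "lo \<le> hi" "u \<in> admissible lo hi"
    and "sorted (y # map snd ws)" "\<forall>(t, z) \<in> set ((s, y) # ws). 0 \<le> t \<and> integral {0..t} u = z"
  shows "successively (\<lambda>(s, y) (t, z). travel lo hi (z - y) (t - s)) ((s, y) # ws)"
  using assms(4-)
proof (induction ws arbitrary: s y)
  case Nil
  then show ?case by simp
next
  case (Cons w ws)
  obtain t z where w: "w = (t, z)" by force
  have st: "0 \<le> s" "0 \<le> t" "integral {0..s} u = y" "integral {0..t} u = z" "y \<le> z"
    using Cons.prems w by auto
  \<comment> \<open>Reaching \<open>z\<close> before \<open>y\<close> would mean positive progress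
    from \<open>z\<close> to \<open>y\<close>, because the minimal speed is positive; but
    \<open>y \<le> z\<close>.\<close>
  have "s \<le> t"
  proof (rule ccontr)
    assume "\<not> s \<le> t"
    then have "travel lo hi (y - z) (s - t)"
      using admissible_travel[OF assms(3), of t s] st by simp
    then have "lo * (s - t) \<le> 0" using st by (simp add: travel_def)
    with \<open>\<not> s \<le> t\<close> \<open>0 < lo\<close> show False by (simp add: mult_le_0_iff)
  qed
  then have "travel lo hi (z - y) (t - s)"
    using admissible_travel[OF assms(3), of s t] st by simp
  moreover have "successively (\<lambda>(s, y) (t, z). travel lo hi (z - y) (t - s)) ((t, z) # ws)"
    using Cons.IH[of z t] Cons.prems w by auto
  ultimately show ?case using w by simp
qed

text \<open>Turns the quantifiers over input signals in \<open>entry_times\<close> and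
  \<open>exit_times\<close> into inequalities, one per leg. Waypoints are displacements from the
  initial position, hence the start \<open>(0, 0)\<close>.\<close>

lemma ex_signal_iff:
  assumes "0 < lo" "lo \<le> hi" "sorted (0 # map snd ws)" "\<forall>(t, z) \<in> set ws. 0 \<le> t"
  shows "(\<exists>u \<in> admissible lo hi. \<forall>(t, z) \<in> set ws. integral {0..t} u = z) \<longleftrightarrow>
    successively (\<lambda>(s, y) (t, z). travel lo hi (z - y) (t - s)) ((0, 0) # ws)"
proof
  assume "\<exists>u \<in> admissible lo hi. \<forall>(t, z) \<in> set ws. integral {0..t} u = z"
  then obtain u where "u \<in> admissible lo hi" "\<forall>(t, z) \<in> set ws. integral {0..t} u = z" by blast
  then show "successively (\<lambda>(s, y) (t, z). travel lo hi (z - y) (t - s)) ((0, 0) # ws)"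
    using assms by (intro waypoints_travel[where u = u]) auto
next
  assume "successively (\<lambda>(s, y) (t, z). travel lo hi (z - y) (t - s)) ((0, 0) # ws)"
  from signal_through_waypoints[OF assms(1,2) const_admissible[OF assms(2)] _ _ assms(3) this]
  show "\<exists>u \<in> admissible lo hi. \<forall>(t, z) \<in> set ws. integral {0..t} u = z"
    by auto
qed

text \<open>Possible entry times will form a closed interval, so that obeying release time and
  deadline is membership in it. If the interval is empty, its infimum is infinite and both sides are
  false.\<close>

lemma Inf_Sup_ereal_interval_iff:
  "Inf (ereal ` {l..r}) \<le> ereal t \<and> ereal t \<le> Sup (ereal ` {l..r}) \<longleftrightarrow> t \<in> {l..r}"
proof (cases "l \<le> r")
  case True
  have "Inf (ereal ` {l..r}) = ereal l"
    using True by (intro Inf_eqI) auto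
  moreover have "Sup (ereal ` {l..r}) = ereal r"
    using True by (intro Sup_eqI) auto
  ultimately show ?thesis by simp
next
  case False
  then show ?thesis by (simp add: top_ereal_def)
qed


section \<open>Routes\<close>

locale integrator_traffic =
  fixes I :: integrator_instance
  assumes valid: "valid_instance I"
begin

abbreviation S :: "(real, real) traffic" where "S \<equiv> single_integrator I"
abbreviation J :: integrator_instance where "J \<equiv> residual (x_init I) I"
abbreviation feasible :: "nat \<Rightarrow> real \<Rightarrow> real \<Rightarrow> bool" where
  "feasible j \<equiv> travel (u_min I j) (u_max I j)"

text \<open>
  For an operation that is still of interest, a vehicle that is inside the area at time 0 is
  treated as entering it there, which makes the separate cases of both problems uniform.
\<close>

definition entry :: "nat \<Rightarrow> nat \<Rightarrow> real" where
  "entry i j = max (alpha I i j) (x_init I j)"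

lemma S_sel [simp]:
  "ops S = ops I" "alpha S = alpha I" "beta S = beta I" "pos0 S j = x_init I j"
  "conj_arcs S = conj_arcs I" "signals S j = admissible (u_min I j) (u_max I j)"
  "pos S j t u = x_init I j + integral {0..t} u"
  by (simp_all add: single_integrator_def pos0_def pos_def conj_arcs_def admissible_def)

lemma J_sel [simp]:
  "alpha J = alpha I" "beta J = beta I" "x_init J = x_init I" "u_min J = u_min I"
  "u_max J = u_max I"
  by (simp_all add: residual_def)

lemma ops_J: "(i, j) \<in> ops J \<longleftrightarrow> (i, j) \<in> ops I \<and> x_init I j < beta I i j"
  by (simp add: residual_def)

lemma disj_arcs_S: "disj_arcs (residual (pos0 S) S) = disj_arcs J"
  by (simp add: disj_arcs_def residual_def)

lemma alpha_less_beta: "(i, j) \<in> ops I \<Longrightarrow> alpha I i j < beta I i j"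
  using valid unfolding valid_instance_def valid_layout_def by blast

lemma areas_apart:
  "(i, j) \<in> ops I \<Longrightarrow> (i', j) \<in> ops I \<Longrightarrow> i \<noteq> i' \<Longrightarrow>
    beta I i j \<le> alpha I i' j \<or> beta I i' j \<le> alpha I i j"
  using valid unfolding valid_instance_def valid_layout_def by blast

lemma areas_disjoint:
  assumes "(i, j) \<in> ops I" "(i', j) \<in> ops I" "alpha I i j < alpha I i' j"
  shows "beta I i j \<le> alpha I i' j"
proof -
  have "i \<noteq> i'" using assms by auto
  then show ?thesis
    using areas_apart[OF assms(1,2)] alpha_less_beta[OF assms(2)] assms(3) by linarith
qed

text \<open>Two areas of positive length with the same left end would overlap.\<close>

lemma alpha_inj:
  assumes "(i, j) \<in> ops I" "(i', j) \<in> ops I" "alpha I i j = alpha I i' j"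
  shows "i = i'"
  using areas_apart[OF assms(1,2)] alpha_less_beta[OF assms(1)] alpha_less_beta[OF assms(2)]
    assms(3) by linarith

lemma speed:
  assumes "(i, j) \<in> ops I"
  shows "0 < u_min I j" "u_min I j \<le> u_max I j"
proof -
  have "j \<in> {1..num_vehicles I}"
    using assms valid unfolding valid_instance_def valid_layout_def by blast
  then show "0 < u_min I j" "u_min I j \<le> u_max I j"
    using valid unfolding valid_instance_def by blast+
qed

lemma finite_ops: "finite (ops I)"
proof -
  have "ops I \<subseteq> {1..num_areas I} \<times> {1..num_vehicles I}"
    using valid unfolding valid_instance_def valid_layout_def by blast
  then show ?thesis by (rule finite_subset) simp
qed

lemma arcD:
  assumes "(i, i', j) \<in> conj_arcs I"
  shows "(i, j) \<in> ops I" "(i', j) \<in> ops I" "alpha I i j < alpha I i' j"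
    "beta I i j \<le> alpha I i' j"
proof -
  show *: "(i, j) \<in> ops I" "(i', j) \<in> ops I" "alpha I i j < alpha I i' j"
    using assms unfolding conj_arcs_def by blast+
  show "beta I i j \<le> alpha I i' j" using areas_disjoint[OF *] .
qed

lemma arc_adjacent:
  "(i, i', j) \<in> conj_arcs I \<Longrightarrow> (k, j) \<in> ops I \<Longrightarrow>
    alpha I k j \<le> alpha I i j \<or> alpha I i' j \<le> alpha I k j"
  unfolding conj_arcs_def using not_le by blast

text \<open>Neither predecessor can lie strictly between the other one and \<open>k\<close>, so each
  starts no later than the other.\<close>

lemma pred_unique:
  assumes "(i, k, j) \<in> conj_arcs I" "(i', k, j) \<in> conj_arcs I"
  shows "i = i'"
proof (rule alpha_inj)
  show "(i, j) \<in> ops I" "(i', j) \<in> ops I" using assms arcD(1) by blast+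
  then show "alpha I i j = alpha I i' j"
    using arc_adjacent[OF assms(1)] arc_adjacent[OF assms(2)] arcD(3)[OF assms(1)]
      arcD(3)[OF assms(2)] by fastforce
qed

lemma succ_unique:
  assumes "(k, i, j) \<in> conj_arcs I" "(k, i', j) \<in> conj_arcs I"
  shows "i = i'"
proof (rule alpha_inj)
  show "(i, j) \<in> ops I" "(i', j) \<in> ops I" using assms arcD(2) by blast+
  then show "alpha I i j = alpha I i' j"
    using arc_adjacent[OF assms(1)] arc_adjacent[OF assms(2)] arcD(3)[OF assms(1)]
      arcD(3)[OF assms(2)] by fastforce
qed

text \<open>The operations dropped from a route form an initial segment of it, so no new neighbours
  arise: whatever starts after an area that is still of interest is of interest too.\<close>

lemma arc_J: "(i, i', j) \<in> conj_arcs J \<longleftrightarrow> (i, i', j) \<in> conj_arcs I \<and> x_init I j < beta I i j"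
proof
  assume arc: "(i, i', j) \<in> conj_arcs J"
  then have *: "(i, j) \<in> ops I" "(i', j) \<in> ops I" "alpha I i j < alpha I i' j"
    "x_init I j < beta I i j"
    by (auto simp: conj_arcs_def ops_J)
  have "False" if "(k, j) \<in> ops I" "alpha I i j < alpha I k j" "alpha I k j < alpha I i' j" for k
  proof -
    have "(k, j) \<in> ops J"
      using areas_disjoint[OF *(1) that(1,2)] alpha_less_beta[OF that(1)] * that
      by (simp add: ops_J)
    with arc that show False by (auto simp: conj_arcs_def)
  qed
  with * show "(i, i', j) \<in> conj_arcs I \<and> x_init I j < beta I i j"
    by (auto simp: conj_arcs_def)
next
  assume arc: "(i, i', j) \<in> conj_arcs I \<and> x_init I j < beta I i j"
  then have "x_init I j < beta I i' j"
    using arcD[of i i' j] alpha_less_beta[of i' j] by auto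
  with arc show "(i, i', j) \<in> conj_arcs J"
    by (auto simp: conj_arcs_def ops_J)
qed

lemma arc_JD:
  assumes "(i, i', j) \<in> conj_arcs J"
  shows "(i, i', j) \<in> conj_arcs I" "(i, j) \<in> ops J" "(i', j) \<in> ops J"
    "entry i j < beta I i j" "beta I i j \<le> alpha I i' j" "entry i' j = alpha I i' j"
    "x_init I j < alpha I i' j" "(i, j) \<notin> last_ops J"
proof -
  show *: "(i, i', j) \<in> conj_arcs I" "(i, j) \<in> ops J" "(i', j) \<in> ops J"
    "(i, j) \<notin> last_ops J"
    using assms by (auto simp: arc_J last_ops_def)
      (use assms in \<open>auto simp: conj_arcs_def\<close>)
  show "beta I i j \<le> alpha I i' j" "x_init I j < alpha I i' j"
    using arcD[OF *(1)] assms by (auto simp: arc_J)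
  then show "entry i' j = alpha I i' j" "entry i j < beta I i j"
    using alpha_less_beta[of i j] assms by (auto simp: entry_def ops_J arc_J arcD)
qed

lemma entry_bounds:
  assumes "(i, j) \<in> ops J"
  shows "x_init I j \<le> entry i j" "entry i j < beta I i j"
  using assms alpha_less_beta[of i j] by (auto simp: entry_def ops_J)

lemma route_cases:
  assumes "(i, j) \<in> ops J"
  obtains (first) "(i, j) \<in> first_ops J" | (pred) i' where "(i', i, j) \<in> conj_arcs J"
  using assms by (auto simp: first_ops_def)

lemma route_end_cases:
  assumes "(i, j) \<in> ops J"
  obtains (last) "(i, j) \<in> last_ops J" | (succ) i' where "(i, i', j) \<in> conj_arcs J"
  using assms by (auto simp: last_ops_def)

text \<open>Going back to the predecessor decreases the number of areas of vehicle \<open>j\<close>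
  that start earlier.\<close>

lemma route_induct [consumes 1, case_names first arc]:
  assumes "(i, j) \<in> ops J"
    and "\<And>i. (i, j) \<in> first_ops J \<Longrightarrow> P i"
    and arc: "\<And>i i'. (i, i', j) \<in> conj_arcs J \<Longrightarrow> P i \<Longrightarrow> P i'"
  shows "P i"
  using assms(1)
proof (induction "card {k. (k, j) \<in> ops I \<and> alpha I k j < alpha I i j}" arbitrary: i
    rule: less_induct)
  case less
  from less.prems show ?case
  proof (cases rule: route_cases)
    case first
    then show ?thesis using assms by blast
  next
    case (pred i')
    have "{k. (k, j) \<in> ops I} \<subseteq> fst ` ops I" by force
    then have "finite {k. (k, j) \<in> ops I}" using finite_ops finite_subset by blast
    then have "finite {k. (k, j) \<in> ops I \<and> alpha I k j < alpha I i j}"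
      by (rule finite_subset[rotated]) auto
    then have "card {k. (k, j) \<in> ops I \<and> alpha I k j < alpha I i' j}
        < card {k. (k, j) \<in> ops I \<and> alpha I k j < alpha I i j}"
      using arcD(1,3)[OF arc_JD(1)[OF pred]] by (intro psubset_card_mono) auto
    with less.hyps arc pred arc_JD(2)[OF pred] show ?thesis by blast
  qed
qed

text \<open>\<open>exit_times\<close> refers to the arcs of the full layout; by \<open>arc_J\<close>
  an operation without successor in the residual layout has none there either.\<close>

lemma last_opsD:
  assumes "(i, j) \<in> last_ops J"
  shows "(i, j) \<in> ops J" "(i, i', j) \<notin> conj_arcs I"
  using assms by (auto simp: last_ops_def arc_J ops_J)


section \<open>Feasible schedules\<close>

text \<open>The common core of both problems: one condition per leg between consecutive entries, to
  which \<open>in_windows_iff\<close> and \<open>milp_times_iff\<close> reduce the two sets of time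
  constraints.\<close>

definition timely :: "(nat \<Rightarrow> nat \<Rightarrow> real) \<Rightarrow> bool" where
  "timely T \<longleftrightarrow>
     (\<forall>(i, j) \<in> first_ops J. feasible j (entry i j - x_init I j) (T i j)) \<and>
     (\<forall>(i', i, j) \<in> conj_arcs J. feasible j (entry i j - entry i' j) (T i j - T i' j))"

lemma timely_from_start:
  assumes "timely T" "(i, j) \<in> ops J"
  shows "feasible j (entry i j - x_init I j) (T i j)"
  using assms(2)
proof (induction rule: route_induct)
  case (first i)
  then show ?case using assms(1) by (auto simp: timely_def)
next
  case (arc i i')
  then have "feasible j (entry i' j - entry i j) (T i' j - T i j)"
    using assms(1) by (auto simp: timely_def)
  from travel_add[OF this arc.IH] show ?case by simp
qed

lemma feasible_from_start:
  assumes "(i, j) \<in> ops J" "feasible j (entry i j - x_init I j) (T i j)"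
  shows "0 \<le> T i j" "alpha I i j \<le> x_init I j \<Longrightarrow> T i j = 0"
proof -
  note sp = speed[of i j]
  show "0 \<le> T i j"
    using travel_nonneg[OF assms(2)] entry_bounds[OF assms(1)] assms(1) sp by (simp add: ops_J)
  show "T i j = 0" if "alpha I i j \<le> x_init I j"
    using assms that travel_0_iff[OF sp] by (simp add: ops_J entry_def max_def split: if_splits)
qed

section \<open>Entry times, release times and deadlines\<close>

lemma entry_times_first:
  assumes "(i, j) \<in> first_ops J" "x_init I j < alpha I i j"
  shows "entry_times S T i j = {t. feasible j (alpha I i j - x_init I j) t}"
proof -
  have op: "(i, j) \<in> ops I" using assms by (simp add: first_ops_def ops_J)
  note sp = speed[OF op]
  \<comment> \<open>In the full layout the operation may have a predecessor, but the vehicle has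
    then left that area and is strictly past its left end, so \<open>entry_times\<close> imposes no
    constraint.\<close>
  have "\<not> ((i', i, j) \<in> conj_arcs I \<and> x_init I j \<le> alpha I i' j)" for i'
    using assms(1) alpha_less_beta[of i' j] arcD(1)[of i' i j]
    by (force simp: first_ops_def arc_J)
  then have "entry_times S T i j = {t. 0 \<le> t \<and> (\<exists>u \<in> admissible (u_min I j) (u_max I j).
      \<forall>(t, z) \<in> set [(t, alpha I i j - x_init I j)]. integral {0..t} u = z)}"
    unfolding entry_times_def by (auto simp: algebra_simps)
  also have "\<dots> = {t. 0 \<le> t \<and> feasible j (alpha I i j - x_init I j) t}"
  proof (intro Collect_cong conj_cong refl)
    fix t :: real assume "0 \<le> t"
    then show "(\<exists>u \<in> admissible (u_min I j) (u_max I j).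
        \<forall>(t, z) \<in> set [(t, alpha I i j - x_init I j)]. integral {0..t} u = z) \<longleftrightarrow>
        feasible j (alpha I i j - x_init I j) t"
      using assms(2) by (subst ex_signal_iff[OF sp]) auto
  qed
  also have "\<dots> = {t. feasible j (alpha I i j - x_init I j) t}"
    using travel_nonneg[OF _ _ sp] assms(2) by auto
  finally show ?thesis .
qed

text \<open>The hypothesis on \<open>T i' j\<close> says that the predecessor can be entered on
  schedule; what remains is the condition on the final leg.\<close>

lemma entry_times_arc:
  assumes arc: "(i', i, j) \<in> conj_arcs J"
    and T': "feasible j (entry i' j - x_init I j) (T i' j)"
  shows "entry_times S T i j = {t. feasible j (alpha I i j - entry i' j) (t - T i' j)}"
proof -
  let ?x = "x_init I j" and ?A = "admissible (u_min I j) (u_max I j)"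
  note ij = arc_JD[OF arc]
  have op: "(i, j) \<in> ops I" using ij by (simp add: ops_J)
  note sp = speed[OF op]
  note T0 = feasible_from_start[where T = T, OF ij(2) T']
  have pred: "(k, i, j) \<in> conj_arcs I \<longleftrightarrow> k = i'" for k
    using ij(1) pred_unique by blast
  have "(\<exists>u \<in> ?A. pos S j t u = alpha S i j \<and>
     (\<forall>k. (k, i, j) \<in> conj_arcs S \<and> pos0 S j \<le> alpha S k j \<longrightarrow>
        pos S j (T k j) u = alpha S k j)) \<longleftrightarrow> feasible j (alpha I i j - entry i' j) (t - T i' j)"
    (is "?L \<longleftrightarrow> ?R") if "0 \<le> t" for t
  proof (cases "?x \<le> alpha I i' j")
    case True
    then have "?L \<longleftrightarrow> (\<exists>u \<in> ?A. \<forall>(t, z) \<in> set [(T i' j, entry i' j - ?x), (t, alpha I i j - ?x)].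
        integral {0..t} u = z)"
      by (auto simp: pred entry_def algebra_simps)
    also have "\<dots> \<longleftrightarrow> ?R"
      using T' T0(1) True that ij(4-7) by (subst ex_signal_iff[OF sp]) (auto simp: entry_def)
    finally show ?thesis .
  next
    case False
    \<comment> \<open>The vehicle starts inside the preceding area: there is no constraint on that
      entry, but \<open>T i' j = 0\<close> and \<open>entry i' j\<close> is the initial position, so
      the single leg gives the same condition.\<close>
    then have "?L \<longleftrightarrow> (\<exists>u \<in> ?A. \<forall>(t, z) \<in> set [(t, alpha I i j - ?x)]. integral {0..t} u = z)"
      by (auto simp: pred algebra_simps)
    also have "\<dots> \<longleftrightarrow> ?R"
      using T0 False that ij(4-7) by (subst ex_signal_iff[OF sp]) (auto simp: entry_def)
    finally show ?thesis .
  qed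
  then have "entry_times S T i j =
      {t. 0 \<le> t \<and> feasible j (alpha I i j - entry i' j) (t - T i' j)}"
    unfolding entry_times_def by auto
  also have "\<dots> = {t. feasible j (alpha I i j - entry i' j) (t - T i' j)}"
    using travel_nonneg[OF _ _ sp] T0(1) ij(4,5) by fastforce
  finally show ?thesis .
qed

lemma feasible_interval:
  assumes "(i, j) \<in> ops I"
  shows "{t. feasible j d (t - s)} = {s + d / u_max I j..s + d / u_min I j}"
  using speed[OF assms] by (auto simp: travel_iff)

lemma Inf_Sup_feasible_iff:
  assumes "(i, j) \<in> ops I"
  shows "Inf (ereal ` {t. feasible j d (t - s)}) \<le> ereal t \<and>
    ereal t \<le> Sup (ereal ` {t. feasible j d (t - s)}) \<longleftrightarrow> feasible j d (t - s)"
  unfolding feasible_interval[OF assms] Inf_Sup_ereal_interval_iff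
  by (simp flip: feasible_interval[OF assms])

lemma window_first_iff:
  assumes "(i, j) \<in> first_ops J"
  shows "release S T i j \<le> ereal (T i j) \<and> ereal (T i j) \<le> deadline S T i j \<longleftrightarrow>
    feasible j (entry i j - x_init I j) (T i j)"
proof -
  have op: "(i, j) \<in> ops I" using assms by (simp add: first_ops_def ops_J)
  show ?thesis
  proof (cases "x_init I j < alpha I i j")
    case True
    then show ?thesis
      using Inf_Sup_feasible_iff[OF op, of "alpha I i j - x_init I j" 0]
      by (simp add: release_def deadline_def entry_times_first[OF assms] entry_def)
  next
    case False
    then have "entry i j - x_init I j = 0" by (simp add: entry_def)
    then have "feasible j (entry i j - x_init I j) (T i j) \<longleftrightarrow> T i j = 0"
      using travel_0_iff[OF speed[OF op]] by simp
    then show ?thesis using False by (auto simp: release_def deadline_def)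
  qed
qed

lemma window_arc_iff:
  assumes arc: "(i', i, j) \<in> conj_arcs J"
    and T': "feasible j (entry i' j - x_init I j) (T i' j)"
  shows "release S T i j \<le> ereal (T i j) \<and> ereal (T i j) \<le> deadline S T i j \<longleftrightarrow>
    feasible j (entry i j - entry i' j) (T i j - T i' j)"
proof -
  have op: "(i, j) \<in> ops I" using arc_JD[OF arc] by (simp add: ops_J)
  have "entry_times S T i j = {t. feasible j (entry i j - entry i' j) (t - T i' j)}"
    using entry_times_arc[where T = T, OF assms] arc_JD(6)[OF arc] by simp
  then show ?thesis
    using Inf_Sup_feasible_iff[OF op] arc_JD(7)[OF arc]
    by (simp add: release_def deadline_def)
qed

definition in_windows :: "(nat \<Rightarrow> nat \<Rightarrow> real) \<Rightarrow> bool" where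
  "in_windows T \<longleftrightarrow> (\<forall>(i, j) \<in> ops I. 0 \<le> T i j \<and> release S T i j \<le> ereal (T i j) \<and>
     ereal (T i j) \<le> deadline S T i j)"

text \<open>\<open>window_arc_iff\<close> presupposes that the predecessor is reachable on schedule,
  so the windows are converted one by one along the route. For an area already left, release time
  and deadline are both 0.\<close>

lemma in_windows_iff:
  "in_windows T \<longleftrightarrow> timely T \<and> (\<forall>(i, j) \<in> ops I - ops J. T i j = 0)"
proof
  assume win: "in_windows T"
  have win': "release S T i j \<le> ereal (T i j) \<and> ereal (T i j) \<le> deadline S T i j"
    if "(i, j) \<in> ops I" for i j
    using win that unfolding in_windows_def by blast
  have start: "feasible j (entry i j - x_init I j) (T i j)" if "(i, j) \<in> ops J" for i j
    using that
  proof (induction rule: route_induct)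
    case (first i)
    then show ?case
      using win' window_first_iff[where T = T, OF first] by (simp add: first_ops_def ops_J)
  next
    case (arc i i')
    have "feasible j (entry i' j - entry i j) (T i' j - T i j)"
      using win' window_arc_iff[where T = T, OF arc] arc_JD(3)[OF arc.hyps] by (simp add: ops_J)
    from travel_add[OF this arc.IH] show ?case by simp
  qed
  have "timely T"
    unfolding timely_def
  proof (intro conjI ballI; clarsimp)
    fix i j assume "(i, j) \<in> first_ops J"
    then show "feasible j (entry i j - x_init I j) (T i j)"
      using start by (simp add: first_ops_def)
  next
    fix i' i j assume arc: "(i', i, j) \<in> conj_arcs J"
    then show "feasible j (entry i j - entry i' j) (T i j - T i' j)"
      using win' window_arc_iff[where T = T, OF arc start] arc_JD(2,3)[OF arc]
      by (simp add: ops_J)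
  qed
  moreover have "T i j = 0" if "(i, j) \<in> ops I - ops J" for i j
    using that win'[of i j] alpha_less_beta[of i j]
    by (auto simp: ops_J release_def deadline_def split: if_splits)
  ultimately show "timely T \<and> (\<forall>(i, j) \<in> ops I - ops J. T i j = 0)" by blast
next
  assume *: "timely T \<and> (\<forall>(i, j) \<in> ops I - ops J. T i j = 0)"
  have "0 \<le> T i j \<and> release S T i j \<le> ereal (T i j) \<and> ereal (T i j) \<le> deadline S T i j"
    if op: "(i, j) \<in> ops I" for i j
  proof (cases "(i, j) \<in> ops J")
    case True
    note start = timely_from_start[OF conjunct1[OF *]]
    from True have "release S T i j \<le> ereal (T i j) \<and> ereal (T i j) \<le> deadline S T i j"
    proof (cases rule: route_cases)
      case first
      then show ?thesis using window_first_iff[where T = T, OF first] * by (auto simp: timely_def)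
    next
      case (pred i')
      then show ?thesis
        using window_arc_iff[where T = T, OF pred start[OF arc_JD(2)[OF pred]]] * by (auto simp: timely_def)
    qed
    then show ?thesis using feasible_from_start(1)[where T = T, OF True start[OF True]] by simp
  next
    case False
    then have "T i j = 0" using op * by blast
    then show ?thesis
      using op False alpha_less_beta[OF op]
      by (auto simp: ops_J release_def deadline_def)
  qed
  then show "in_windows T" by (auto simp: in_windows_def)
qed

section \<open>Exit times and process times\<close>

lemma exit_times_last:
  assumes last: "(i, j) \<in> last_ops J"
    and T: "feasible j (entry i j - x_init I j) (T i j)"
  shows "exit_times S T i j = {t. feasible j (beta I i j - entry i j) (t - T i j)}"
proof -
  let ?x = "x_init I j" and ?A = "admissible (u_min I j) (u_max I j)"
  note ij = last_opsD[OF last]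
  have op: "(i, j) \<in> ops I" using ij by (simp add: ops_J)
  note sp = speed[OF op] and eb = entry_bounds[OF ij(1)]
  note T0 = feasible_from_start[where T = T, OF ij(1) T]
  have "(\<exists>u \<in> ?A. pos S j t u = beta S i j \<and>
     (pos0 S j < alpha S i j \<longrightarrow> pos S j (T i j) u = alpha S i j) \<and>
     (\<forall>i'. (i, i', j) \<in> conj_arcs S \<longrightarrow> pos S j (T i' j) u = alpha S i' j)) \<longleftrightarrow>
     feasible j (beta I i j - entry i j) (t - T i j)" (is "?L \<longleftrightarrow> ?R") if "0 \<le> t" for t
  proof (cases "?x < alpha I i j")
    case True
    then have "?L \<longleftrightarrow> (\<exists>u \<in> ?A. \<forall>(t, z) \<in> set [(T i j, entry i j - ?x), (t, beta I i j - ?x)].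
        integral {0..t} u = z)"
      by (auto simp: ij(2) entry_def algebra_simps)
    also have "\<dots> \<longleftrightarrow> ?R"
      using T T0(1) True that eb by (subst ex_signal_iff[OF sp]) auto
    finally show ?thesis .
  next
    case False
    then have "?L \<longleftrightarrow> (\<exists>u \<in> ?A. \<forall>(t, z) \<in> set [(t, beta I i j - ?x)]. integral {0..t} u = z)"
      by (auto simp: ij(2) algebra_simps)
    also have "\<dots> \<longleftrightarrow> ?R"
      using T0 False that eb by (subst ex_signal_iff[OF sp]) (auto simp: entry_def)
    finally show ?thesis .
  qed
  then have "exit_times S T i j = {t. 0 \<le> t \<and> feasible j (beta I i j - entry i j) (t - T i j)}"
    unfolding exit_times_def by auto
  also have "\<dots> = {t. feasible j (beta I i j - entry i j) (t - T i j)}"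
    using travel_nonneg[OF _ _ sp] T0(1) eb by fastforce
  finally show ?thesis .
qed

text \<open>The exit is a waypoint between two consecutive entries and splits the leg between them
  in two.\<close>

lemma exit_times_arc:
  assumes arc: "(i, i', j) \<in> conj_arcs J" and T: "timely T"
  shows "exit_times S T i j = {t. feasible j (beta I i j - entry i j) (t - T i j) \<and>
    feasible j (alpha I i' j - beta I i j) (T i' j - t)}"
proof -
  let ?x = "x_init I j" and ?A = "admissible (u_min I j) (u_max I j)"
  note ij = arc_JD[OF arc]
  have op: "(i, j) \<in> ops I" using ij by (simp add: ops_J)
  note sp = speed[OF op] and eb = entry_bounds[OF ij(2)]
  note start = timely_from_start[OF T ij(2)]
  note T0 = feasible_from_start[where T = T, OF ij(2) start]
  have T0': "0 \<le> T i' j" using feasible_from_start(1)[where T = T, OF ij(3) timely_from_start[OF T ij(3)]] .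
  have succ: "(i, k, j) \<in> conj_arcs I \<longleftrightarrow> k = i'" for k
    using ij(1) succ_unique by blast
  have "(\<exists>u \<in> ?A. pos S j t u = beta S i j \<and>
     (pos0 S j < alpha S i j \<longrightarrow> pos S j (T i j) u = alpha S i j) \<and>
     (\<forall>k. (i, k, j) \<in> conj_arcs S \<longrightarrow> pos S j (T k j) u = alpha S k j)) \<longleftrightarrow>
     feasible j (beta I i j - entry i j) (t - T i j) \<and>
     feasible j (alpha I i' j - beta I i j) (T i' j - t)" (is "?L \<longleftrightarrow> ?R") if "0 \<le> t" for t
  proof (cases "?x < alpha I i j")
    case True
    then have "?L \<longleftrightarrow> (\<exists>u \<in> ?A. \<forall>(t, z) \<in> set [(T i j, entry i j - ?x), (t, beta I i j - ?x),
        (T i' j, alpha I i' j - ?x)]. integral {0..t} u = z)"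
      by (auto simp: succ entry_def algebra_simps)
    also have "\<dots> \<longleftrightarrow> ?R"
      using start T0(1) T0' True that eb ij(5) by (subst ex_signal_iff[OF sp]) auto
    finally show ?thesis .
  next
    case False
    then have "?L \<longleftrightarrow> (\<exists>u \<in> ?A. \<forall>(t, z) \<in> set [(t, beta I i j - ?x), (T i' j, alpha I i' j - ?x)].
        integral {0..t} u = z)"
      by (auto simp: succ algebra_simps)
    also have "\<dots> \<longleftrightarrow> ?R"
      using T0 T0' False that eb ij(5) by (subst ex_signal_iff[OF sp]) (auto simp: entry_def)
    finally show ?thesis .
  qed
  then have "exit_times S T i j = {t. 0 \<le> t \<and> feasible j (beta I i j - entry i j) (t - T i j) \<and>
      feasible j (alpha I i' j - beta I i j) (T i' j - t)}"
    unfolding exit_times_def by auto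
  also have "\<dots> = {t. feasible j (beta I i j - entry i j) (t - T i j) \<and>
      feasible j (alpha I i' j - beta I i j) (T i' j - t)}"
    using travel_nonneg[OF _ _ sp] T0(1) eb by fastforce
  finally show ?thesis .
qed

lemma process_eq: "(i, j) \<in> ops J \<Longrightarrow> process S T i j = Inf (ereal ` exit_times S T i j)"
  by (simp add: process_def ops_J)

text \<open>The exit times form a nonempty closed interval, so the infimum in \<open>process\<close>
  is finite and attained.\<close>

lemma least_exit:
  assumes T: "timely T" and op: "(i, j) \<in> ops J"
  shows "\<exists>t \<in> exit_times S T i j. process S T i j = ereal t \<and>
    ((i, j) \<in> last_ops J \<longrightarrow> t = T i j + (beta I i j - entry i j) / u_max I j)"
proof -
  have op': "(i, j) \<in> ops I" using op by (simp add: ops_J)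
  note sp = speed[OF op'] and eb = entry_bounds[OF op]
  have least: "process S T i j = ereal t"
    if "t \<in> exit_times S T i j" "\<And>t'. t' \<in> exit_times S T i j \<Longrightarrow> t \<le> t'" for t
    unfolding process_eq[OF op] using that by (intro Inf_eqI) auto
  from op show ?thesis
  proof (cases rule: route_end_cases)
    case last
    have "exit_times S T i j = {T i j + (beta I i j - entry i j) / u_max I j..
        T i j + (beta I i j - entry i j) / u_min I j}"
      using exit_times_last[where T = T, OF last timely_from_start[OF T op]]
        feasible_interval[OF op'] by simp
    moreover have "(beta I i j - entry i j) / u_max I j \<le> (beta I i j - entry i j) / u_min I j"
      using sp eb by (intro divide_left_mono) auto
    ultimately show ?thesis using least by (intro bexI) auto
  next
    case (succ i')
    \<comment> \<open>The larger of two lower bounds: crossing the area at maximal speed, and not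
      leaving it so early that even minimal speed leads to the next area before
      \<open>T i' j\<close>.\<close>
    define t where "t = max (T i j + (beta I i j - entry i j) / u_max I j)
      (T i' j - (alpha I i' j - beta I i j) / u_min I j)"
    have ex: "exit_times S T i j = {t. (beta I i j - entry i j) / u_max I j \<le> t - T i j \<and>
        t - T i j \<le> (beta I i j - entry i j) / u_min I j \<and>
        (alpha I i' j - beta I i j) / u_max I j \<le> T i' j - t \<and>
        T i' j - t \<le> (alpha I i' j - beta I i j) / u_min I j}"
      using exit_times_arc[OF succ T] sp by (auto simp: travel_iff)
    \<comment> \<open>The duration of the whole leg lies between the summed extreme durations of its
      two parts. Together with the two comparisons of extreme durations below, this puts each lower
      bound on the exit time below each upper bound.\<close>
    have "feasible j (alpha I i' j - entry i j) (T i' j - T i j)"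
      using T succ arc_JD(6)[OF succ] by (auto simp: timely_def)
    then have "(alpha I i' j - entry i j) / u_max I j \<le> T i' j - T i j"
      "T i' j - T i j \<le> (alpha I i' j - entry i j) / u_min I j"
      using sp by (simp_all add: travel_iff)
    moreover have "(beta I i j - entry i j) / u_max I j \<le> (beta I i j - entry i j) / u_min I j"
      using sp eb by (intro divide_left_mono) auto
    moreover have "(alpha I i' j - beta I i j) / u_max I j
        \<le> (alpha I i' j - beta I i j) / u_min I j"
      using sp arc_JD(5)[OF succ] by (intro divide_left_mono) auto
    ultimately have "t \<in> exit_times S T i j"
      unfolding ex t_def by (auto simp: diff_divide_distrib)
    moreover have "t \<le> t'" if "t' \<in> exit_times S T i j" for t'
      using that unfolding ex t_def by auto
    ultimately show ?thesis using least arc_JD(8)[OF succ] by blast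
  qed
qed

lemma exit_times_feasible:
  assumes "timely T" "(i, j) \<in> ops J" "t \<in> exit_times S T i j"
  shows "feasible j (beta I i j - entry i j) (t - T i j)"
  using assms(2)
proof (cases rule: route_end_cases)
  case last
  then show ?thesis using exit_times_last timely_from_start assms by auto
next
  case (succ i')
  then show ?thesis using exit_times_arc assms by auto
qed

text \<open>Some part of the area remains to be crossed after the entry, and the speed is bounded.
  Strictness excludes simultaneous entries into a shared area.\<close>

lemma process_after_entry:
  assumes "timely T" "(i, j) \<in> ops J"
  shows "ereal (T i j) < process S T i j"
proof -
  obtain t where t: "t \<in> exit_times S T i j" "process S T i j = ereal t"
    using least_exit[OF assms] by blast
  have "(beta I i j - entry i j) / u_max I j \<le> t - T i j"
    using exit_times_feasible[OF assms t(1)] speed[of i j] assms(2)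
    by (simp add: travel_iff ops_J)
  moreover have "0 < (beta I i j - entry i j) / u_max I j"
    using speed[of i j] assms(2) entry_bounds[OF assms(2)] by (simp add: ops_J)
  ultimately show ?thesis using t(2) by simp
qed

section \<open>The MILP constraints as conditions on exit times\<close>

text \<open>The bounds on \<open>p i j\<close> and those along the arc to the next area are the two
  conditions of \<open>exit_times_arc\<close> at the time \<open>T i j + p i j\<close>. Their sum is
  the condition of \<open>timely\<close> on the whole leg.\<close>

lemma milp_times_iff:
  "milp_times J T p \<longleftrightarrow> timely T \<and> (\<forall>(i, j) \<in> ops J. T i j + p i j \<in> exit_times S T i j) \<and>
    (\<forall>(i, j) \<in> last_ops J. p i j = (beta I i j - entry i j) / u_max I j)"
proof -
  have A: "(if x_init I j < alpha I i j
        then (alpha I i j - x_init I j) / u_max I j \<le> T i j \<and>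
             T i j \<le> (alpha I i j - x_init I j) / u_min I j
        else T i j = 0) \<longleftrightarrow> feasible j (entry i j - x_init I j) (T i j)"
    if "(i, j) \<in> first_ops J" for i j
    using that speed[of i j] travel_0_iff[of "u_min I j" "u_max I j"]
    by (auto simp: first_ops_def ops_J entry_def travel_iff)
  have B: "T i' j + p i' j + (alpha I i j - beta I i' j) / u_max I j \<le> T i j \<and>
        T i j \<le> T i' j + p i' j + (alpha I i j - beta I i' j) / u_min I j \<longleftrightarrow>
        feasible j (alpha I i j - beta I i' j) (T i j - (T i' j + p i' j))"
    if "(i', i, j) \<in> conj_arcs J" for i' i j
    using that speed[of i j] arc_JD(3)[OF that] by (auto simp: ops_J travel_iff)
  have C: "(if x_init I j < alpha I i j
        then (beta I i j - alpha I i j) / u_max I j \<le> p i j \<and>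
             p i j \<le> (beta I i j - alpha I i j) / u_min I j
        else (beta I i j - x_init I j) / u_max I j \<le> p i j \<and>
             p i j \<le> (beta I i j - x_init I j) / u_min I j) \<longleftrightarrow>
        feasible j (beta I i j - entry i j) (p i j)"
    if "(i, j) \<in> ops J - last_ops J" for i j
    using that speed[of i j] by (auto simp: ops_J entry_def travel_iff max_def)
  have last: "(if x_init I j < alpha I i j then (beta I i j - alpha I i j) / u_max I j
      else (beta I i j - x_init I j) / u_max I j) = (beta I i j - entry i j) / u_max I j" for i j
    by (simp add: entry_def)
  have milp: "milp_times J T p \<longleftrightarrow>
      (\<forall>(i, j) \<in> first_ops J. feasible j (entry i j - x_init I j) (T i j)) \<and>
      (\<forall>(i', i, j) \<in> conj_arcs J.
        feasible j (alpha I i j - beta I i' j) (T i j - (T i' j + p i' j))) \<and>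
      (\<forall>(i, j) \<in> ops J - last_ops J. feasible j (beta I i j - entry i j) (p i j)) \<and>
      (\<forall>(i, j) \<in> last_ops J. p i j = (beta I i j - entry i j) / u_max I j)"
    unfolding milp_times_def J_sel last
    by (intro arg_cong2[where f = "(\<and>)"] ball_cong refl;
        simp only: split_paired_all prod.case A B C)
  show ?thesis
  proof
    assume m: "milp_times J T p"
    have "feasible j (entry i j - entry i' j) (T i j - T i' j)"
      if arc: "(i', i, j) \<in> conj_arcs J" for i' i j
    proof -
      have "feasible j (alpha I i j - beta I i' j) (T i j - (T i' j + p i' j))"
        "feasible j (beta I i' j - entry i' j) (p i' j)"
        using m arc_JD(2,8)[OF arc] arc unfolding milp by blast+
      from travel_add[OF this] show ?thesis using arc_JD(6)[OF arc] by simp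
    qed
    then have tim: "timely T" using m unfolding milp timely_def by blast
    have "T i j + p i j \<in> exit_times S T i j" if op: "(i, j) \<in> ops J" for i j
      using op
    proof (cases rule: route_end_cases)
      case last
      have op': "(i, j) \<in> ops I" using op by (simp add: ops_J)
      \<comment> \<open>For a last operation the prescribed \<open>p\<close> is the lower end of the
        range of feasible crossing times.\<close>
      have "p i j = (beta I i j - entry i j) / u_max I j"
        using m last unfolding milp by blast
      moreover have "\<dots> \<le> (beta I i j - entry i j) / u_min I j"
        using speed[OF op'] entry_bounds[OF op] by (intro divide_left_mono) auto
      ultimately show ?thesis
        using exit_times_last[where T = T, OF last timely_from_start[OF tim op]] speed[OF op']
        by (simp add: travel_iff)
    next
      case (succ i')
      then show ?thesis
        using m op arc_JD(8)[OF succ] unfolding milp exit_times_arc[OF succ tim] by fastforce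
    qed
    then show "timely T \<and> (\<forall>(i, j) \<in> ops J. T i j + p i j \<in> exit_times S T i j) \<and>
        (\<forall>(i, j) \<in> last_ops J. p i j = (beta I i j - entry i j) / u_max I j)"
      using tim m unfolding milp by blast
  next
    assume r: "timely T \<and> (\<forall>(i, j) \<in> ops J. T i j + p i j \<in> exit_times S T i j) \<and>
        (\<forall>(i, j) \<in> last_ops J. p i j = (beta I i j - entry i j) / u_max I j)"
    have "feasible j (alpha I i j - beta I i' j) (T i j - (T i' j + p i' j))"
      if arc: "(i', i, j) \<in> conj_arcs J" for i' i j
      using r arc_JD(2)[OF arc] exit_times_arc[OF arc] by auto
    moreover have "feasible j (beta I i j - entry i j) (p i j)" if "(i, j) \<in> ops J" for i j
      using exit_times_feasible[of T i j "T i j + p i j"] r that by auto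
    ultimately show "milp_times J T p" using r unfolding milp timely_def by blast
  qed
qed

section \<open>The two implications for a fixed instance\<close>

lemma job_shop_iff:
  "job_shop S \<longleftrightarrow> (\<exists>T. in_windows T \<and>
    (\<forall>(i, j, j') \<in> disj_arcs J. T i j \<le> T i j' \<longrightarrow> process S T i j \<le> ereal (T i j')))"
  by (simp add: job_shop_def in_windows_def disj_arcs_S)

lemma disj_arcsD:
  "(i, j, j') \<in> disj_arcs J \<Longrightarrow> (i, j) \<in> ops J \<and> (i, j') \<in> ops J \<and> (i, j', j) \<in> disj_arcs J"
  by (auto simp: disj_arcs_def)

lemma job_shop_imp_milp:
  assumes js: "job_shop S" and M: "sufficiently_large I M"
  shows "milp M I"
proof -
  obtain T where win: "in_windows T"
    and order: "\<And>i j j'. (i, j, j') \<in> disj_arcs J \<Longrightarrow> T i j \<le> T i j' \<Longrightarrow>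
      process S T i j \<le> ereal (T i j')"
    using js unfolding job_shop_iff by blast
  have tim: "timely T" using win in_windows_iff by simp
  \<comment> \<open>Every vehicle leaves as early as its schedule permits. Process times are finite
    by \<open>least_exit\<close>, so \<open>real_of_ereal\<close> loses nothing.\<close>
  define p where "p i j = real_of_ereal (process S T i j) - T i j" for i j
  have p: "process S T i j = ereal (T i j + p i j)" "T i j + p i j \<in> exit_times S T i j"
    "(i, j) \<in> last_ops J \<Longrightarrow> p i j = (beta I i j - entry i j) / u_max I j"
    if "(i, j) \<in> ops J" for i j
    using least_exit[OF tim that] by (auto simp: p_def)
  have mt: "milp_times J T p"
    unfolding milp_times_iff using tim p last_opsD(1) by blast
  have M': "T i j + p i j < M" if "(i, j) \<in> ops J" for i j
    using M mt that unfolding sufficiently_large_def Let_def by blast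
  have T0: "0 \<le> T i j" if "(i, j) \<in> ops J" for i j
    using win that by (auto simp: in_windows_def ops_J)
  have T_imp: "T i j + p i j \<le> T i j'" if "(i, j, j') \<in> disj_arcs J" "T i j \<le> T i j'" for i j j'
    using order[OF that] p(1)[of i j] disj_arcsD[OF that(1)] by simp
  \<comment> \<open>With equal entry times, the first vehicle would have to leave by the time it
    enters. Hence exactly one of the two binary variables below is 1.\<close>
  have strict: "T i j \<noteq> T i j'" if "(i, j, j') \<in> disj_arcs J" for i j j'
    using order[OF that] process_after_entry[OF tim, of i j] disj_arcsD[OF that] by fastforce
  define k where "k i j j' = (if T i j \<le> T i j' then 1 else 0 :: real)" for i j j'
  have "milp_order J M T p k"
    unfolding milp_order_def
  proof (intro ballI; clarify)
    fix i j j' assume arc: "(i, j, j') \<in> disj_arcs J"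
    note d = disj_arcsD[OF arc]
    show "k i j j' \<in> {0, 1} \<and> k i j' j \<in> {0, 1} \<and>
        T i j + p i j \<le> T i j' + M * (1 - k i j j') \<and>
        T i j' + p i j' \<le> T i j + M * (1 - k i j' j) \<and> k i j j' + k i j' j = 1"
      \<comment> \<open>In the inequality whose binary variable is 0, the left side is below
        \<open>M\<close>, and the entry time added to \<open>M\<close> is nonnegative.\<close>
      using strict[OF arc] T_imp[OF arc] T_imp[of i j' j] d M'[of i j] M'[of i j'] T0[of i j]
        T0[of i j'] by (auto simp: k_def)
  qed
  then show ?thesis using mt unfolding milp_def Let_def by blast
qed

lemma milp_imp_job_shop:
  assumes "milp M I"
  shows "job_shop S"
proof -
  obtain T p k where mt: "milp_times J T p" and mo: "milp_order J M T p k"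
    using assms unfolding milp_def Let_def by blast
  \<comment> \<open>The job-shop problem also schedules the areas already left, where only time 0 is
    allowed; the MILP says nothing about them.\<close>
  define T' where "T' i j = (if (i, j) \<in> ops J then T i j else 0)" for i j
  have same: "T' i j = T i j" if "(i, j) \<in> ops J" for i j
    using that by (simp add: T'_def)
  have tim: "timely T" using mt milp_times_iff by simp
  have tim': "timely T'"
    using tim arc_JD(2,3) unfolding timely_def
    by (fastforce simp: same first_ops_def)
  have mt': "milp_times J T' p"
    using mt arc_JD(2,3) unfolding milp_times_def
    by (fastforce simp: same first_ops_def)
  \<comment> \<open>\<open>T i j + p i j\<close> is one of the exit times, and the process time is
    their infimum.\<close>
  have exit: "process S T' i j \<le> ereal (T i j + p i j)" if "(i, j) \<in> ops J" for i j
    using mt' that same[OF that] unfolding milp_times_iff process_eq[OF that]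
    by (auto intro!: Inf_lower)
  have p0: "0 < p i j" if "(i, j) \<in> ops J" for i j
    using exit[OF that] process_after_entry[OF tim' that] same[OF that]
    by (metis add.commute add_less_cancel_right add_0 ereal_less_eq(3) order_less_le_trans
        ereal_less(2) less_ereal.simps(1))
  have "in_windows T'"
    using tim' by (auto simp: in_windows_iff T'_def)
  moreover have "process S T' i j \<le> ereal (T' i j')"
    if arc: "(i, j, j') \<in> disj_arcs J" and le: "T' i j \<le> T' i j'" for i j j'
  proof -
    note d = disj_arcsD[OF arc]
    have o: "k i j j' \<in> {0, 1}" "T i j + p i j \<le> T i j' + M * (1 - k i j j')"
      "T i j' + p i j' \<le> T i j + M * (1 - k i j' j)" "k i j j' + k i j' j = 1"
      using mo arc unfolding milp_order_def by blast+
    \<comment> \<open>Otherwise \<open>k i j' j = 1\<close>, and vehicle \<open>j'\<close> would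
      leave the area no later than \<open>j\<close> enters it. As \<open>p i j'\<close> is positive,
      \<open>j'\<close> would then enter strictly before \<open>j\<close>, against
      \<open>le\<close>.\<close>
    have "k i j j' = 1"
      using o le p0[of i j'] d by (auto simp: same)
    then have "T i j + p i j \<le> T' i j'" using o d by (simp add: same)
    then show ?thesis using exit[of i j] d by (meson ereal_less_eq(3) order_trans)
  qed
  ultimately show ?thesis unfolding job_shop_iff by blast
qed

end

section \<open>From instances to polynomial-time equivalence\<close>

lemma job_shop_iff_milp:
  assumes "valid_instance I" "sufficiently_large I M"
  shows "job_shop (single_integrator I) \<longleftrightarrow> milp M I"
proof -
  interpret integrator_traffic I using assms by unfold_locales
  show ?thesis using job_shop_imp_milp milp_imp_job_shop assms by blast
qed

text \<open>Input and output use the same format on the tape, and a program of length 0 has already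
  halted at position 0.\<close>

lemma computes_within_Nil: "computes_within [] xs s xs"
proof -
  have "step [] = id" by (auto simp: step_def)
  then show ?thesis
    by (auto simp: computes_within_def output_on_def input_tape_def)
qed

theorem theorem2:
  fixes M :: "integrator_instance \<Rightarrow> real"
  assumes "\<And>I. valid_instance I \<Longrightarrow> sufficiently_large I (M I)"
  shows "equivalent job_shop_problem (milp_problem M)"
proof -
  have iff: "job_shop (single_integrator I) \<longleftrightarrow> milp (M I) I" if "valid_instance I" for I
    using job_shop_iff_milp that assms by blast
  have "polytime_construction job_shop_problem (milp_problem M) id"
    "polytime_construction (milp_problem M) job_shop_problem id"
    unfolding polytime_construction_def
    \<comment> \<open>Instances and encodings coincide, and any time bound serves, since the empty
      program never changes its configuration.\<close>
    by (rule exI[of _ "[]"], simp add: job_shop_problem_def milp_problem_def computes_within_Nil)+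
  then show ?thesis
    unfolding equivalent_def reducible_def
    using iff by (auto simp: job_shop_problem_def milp_problem_def intro!: exI[of _ id])
qed

end
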